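(* Let $l_+^\infty$ be the set of all bounded sequences of nonnegative real numbers, equipped with the metric $d(x,y)=\sup_{i\in\mathbb{N}}\{c_i\}$, where, for $x=(\mu_i)$ and $y=(\nu_i)$ in $l_+^\infty$, $c_i$ is the nonnegative real number determined by $\max\{\mu_i,\nu_i\}=\min\{\mu_i,\nu_i\}+c_i$ (so $c_i=0$ if $\mu_i=\nu_i$). Then the metric space $(l_+^\infty,d)$ is complete. *)

theory Defs
  imports "HOL-Analysis.Abstract_Metric_Spaces"
begin

definition linf_plus :: "(nat \<Rightarrow> real) set" where
  "linf_plus = {x. (\<forall>i. 0 \<le> x i) \<and> bounded (range x)}"

definition gap :: "real \<Rightarrow> real \<Rightarrow> real" where
  "gap a b = (THE c. 0 \<le> c \<and> max a b = min a b + c)"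

text \<open>The locale \<^locale>\<open>Metric_space\<close> asks for nonnegativity and symmetry of the distance on the
  whole type, not only on the carrier, and the real supremum of an unbounded set is unspecified;
  hence the distance is set to 0 outside \<^const>\<open>linf_plus\<close>.\<close>

definition linf_dist :: "(nat \<Rightarrow> real) \<Rightarrow> (nat \<Rightarrow> real) \<Rightarrow> real" where
  "linf_dist x y =
     (if x \<in> linf_plus \<and> y \<in> linf_plus then (SUP i. gap (x i) (y i)) else 0)"

end

theory Submission
  imports Defs
begin

text \<open>Since \<open>gap a b\<close> is the absolute difference, \<open>linf_dist\<close> is the
  supremum metric on the nonnegative bounded sequences. A Cauchy sequence for it is Cauchy in each
  coordinate, hence has a coordinatewise limit x. Letting one index tend to infinity in the Cauchy
  estimate shows that the convergence is uniform in the coordinate. Uniform closeness to one bounded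
  term makes x bounded, and nonnegativity passes to limits. The lemma
  \<open>linf_dist_le_iff\<close> trades the supremum for coordinatewise estimates, both for the
  metric axioms and for completeness.\<close>

lemma gap_eq_abs_diff: "gap a b = \<bar>a - b\<bar>"
  unfolding gap_def by (rule the_equality) (auto simp: max_def min_def split: if_splits)

lemma linf_plus_iff: "x \<in> linf_plus \<longleftrightarrow> (\<forall>i. 0 \<le> x i) \<and> (\<exists>B. \<forall>i. x i \<le> B)"
proof -
  have "bounded (range x) \<longleftrightarrow> (\<exists>B. \<forall>i. x i \<le> B)" if "\<forall>i. 0 \<le> x i"
    using that by (auto simp: bounded_iff)
  then show ?thesis by (auto simp: linf_plus_def)
qed

text \<open>Boundedness of both sequences bounds their differences, so the real supremum is a
  genuine least upper bound.\<close>

lemma linf_dist_le_iff: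
  assumes "x \<in> linf_plus" "y \<in> linf_plus"
  shows "linf_dist x y \<le> e \<longleftrightarrow> (\<forall>i. \<bar>x i - y i\<bar> \<le> e)"
proof -
  obtain A B where A: "\<And>i. 0 \<le> x i \<and> x i \<le> A" and B: "\<And>i. 0 \<le> y i \<and> y i \<le> B"
    using assms by (auto simp: linf_plus_iff)
  have "\<bar>x i - y i\<bar> \<le> A + B" for i
    using A[of i] B[of i] by linarith
  then have "bdd_above (range (\<lambda>i. \<bar>x i - y i\<bar>))"
    by (auto simp: bdd_above_def)
  then show ?thesis
    using assms by (simp add: linf_dist_def gap_eq_abs_diff cSUP_le_iff)
qed

lemma abs_diff_le_linf_dist:
  assumes "x \<in> linf_plus" "y \<in> linf_plus"
  shows "\<bar>x i - y i\<bar> \<le> linf_dist x y"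
  \<comment> \<open>Take \<open>e\<close> to be the distance itself.\<close>
  using linf_dist_le_iff[OF assms] by blast

lemma linf_dist_commute: "linf_dist x y = linf_dist y x"
  by (simp add: linf_dist_def gap_eq_abs_diff abs_minus_commute conj_commute)

lemma linf_dist_nonneg: "0 \<le> linf_dist x y"
proof (cases "x \<in> linf_plus \<and> y \<in> linf_plus")
  case True
  then show ?thesis
    using order_trans[OF abs_ge_zero abs_diff_le_linf_dist] by blast
next
  case False
  then show ?thesis
    by (auto simp: linf_dist_def)
qed

lemma Metric_space_linf_plus: "Metric_space linf_plus linf_dist"
proof
  fix x y z
  show "0 \<le> linf_dist x y"
    by (rule linf_dist_nonneg)
  show "linf_dist x y = linf_dist y x"
    by (rule linf_dist_commute)
  assume x: "x \<in> linf_plus" and y: "y \<in> linf_plus"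
  \<comment> \<open>Rewritten as an upper bound, vanishing falls under
    \<open>linf_dist_le_iff\<close> and becomes equality in every coordinate.\<close>
  have "linf_dist x y = 0 \<longleftrightarrow> linf_dist x y \<le> 0"
    using linf_dist_nonneg[of x y] by linarith
  then show "linf_dist x y = 0 \<longleftrightarrow> x = y"
    by (simp add: linf_dist_le_iff[OF x y] fun_eq_iff)
  assume z: "z \<in> linf_plus"
  have "\<bar>x i - z i\<bar> \<le> linf_dist x y + linf_dist y z" for i
    using abs_diff_le_linf_dist[OF x y, of i] abs_diff_le_linf_dist[OF y z, of i] by linarith
  then show "linf_dist x z \<le> linf_dist x y + linf_dist y z"
    by (simp add: linf_dist_le_iff[OF x z])
qed

interpretation linf: Metric_space linf_plus linf_dist
  by (rule Metric_space_linf_plus)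

lemma mcomplete_linf_plus: "linf.mcomplete"
  unfolding linf.mcomplete_def
proof (intro allI impI)
  fix s assume "linf.MCauchy s"
  then have s: "\<And>n. s n \<in> linf_plus"
    and Cauchy_dist: "\<And>e. 0 < e \<Longrightarrow> \<exists>N. \<forall>m n. N \<le> m \<longrightarrow> N \<le> n \<longrightarrow> linf_dist (s m) (s n) < e"
    by (auto simp: linf.MCauchy_def)
  have "Cauchy (\<lambda>n. s n i)" for i
  proof (rule metric_CauchyI)
    fix e :: real assume "0 < e"
    then obtain N where "\<And>m n. m \<ge> N \<Longrightarrow> n \<ge> N \<Longrightarrow> linf_dist (s m) (s n) < e"
      using Cauchy_dist by blast
    then show "\<exists>N. \<forall>m\<ge>N. \<forall>n\<ge>N. dist (s m i) (s n i) < e"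
      unfolding dist_real_def using le_less_trans[OF abs_diff_le_linf_dist[OF s s]] by blast
  qed
  then have "\<forall>i. \<exists>l. (\<lambda>n. s n i) \<longlonglongrightarrow> l"
    using Cauchy_convergent convergent_def by blast
  then obtain x where x: "\<And>i. (\<lambda>n. s n i) \<longlonglongrightarrow> x i"
    by metis
  \<comment> \<open>The point is that N serves all coordinates at once.\<close>
  have tail: "\<exists>N. \<forall>n\<ge>N. \<forall>i. \<bar>s n i - x i\<bar> \<le> e" if e: "0 < e" for e
  proof -
    obtain N where N: "\<And>m n. m \<ge> N \<Longrightarrow> n \<ge> N \<Longrightarrow> linf_dist (s m) (s n) < e"
      using Cauchy_dist[OF e] by blast
    \<comment> \<open>With n and i fixed, let m tend to infinity in the Cauchy estimate; N comes
      from the supremum distance and so does not depend on i. The limit keeps only the non-strict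
      inequality.\<close>
    have "\<bar>s n i - x i\<bar> \<le> e" if n: "n \<ge> N" for n i
    proof (rule LIMSEQ_le_const2)
      show "(\<lambda>m. \<bar>s n i - s m i\<bar>) \<longlonglongrightarrow> \<bar>s n i - x i\<bar>"
        by (intro tendsto_intros x)
      show "\<exists>M. \<forall>m\<ge>M. \<bar>s n i - s m i\<bar> \<le> e"
        using order_trans[OF abs_diff_le_linf_dist[OF s s] less_imp_le[OF N[OF n]]] by blast
    qed
    then show ?thesis by blast
  qed
  have "x \<in> linf_plus"
  proof -
    have "0 \<le> x i" for i
      by (rule LIMSEQ_le_const[OF x]) (use s in \<open>auto simp: linf_plus_iff\<close>)
    \<comment> \<open>One term uniformly within 1 of x is enough: its bound plus 1 bounds x.\<close>
    moreover obtain N where N: "\<And>i. \<bar>s N i - x i\<bar> \<le> 1"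
      using tail[of 1] by auto
    moreover obtain B where B: "\<And>i. s N i \<le> B"
      using s[of N] by (auto simp: linf_plus_iff)
    moreover have "x i \<le> B + 1" for i
      using N[of i] B[of i] by linarith
    ultimately show ?thesis
      by (auto simp: linf_plus_iff)
  qed
  moreover have "\<exists>N. \<forall>n\<ge>N. s n \<in> linf_plus \<and> linf_dist (s n) x < e" if "0 < e" for e
  proof -
    \<comment> \<open>Coordinatewise bounds control the supremum only up to \<open>\<le>\<close>;
      halving \<open>e\<close> recovers the strict inequality.\<close>
    obtain N where "\<And>n i. n \<ge> N \<Longrightarrow> \<bar>s n i - x i\<bar> \<le> e / 2"
      using tail[of "e / 2"] \<open>0 < e\<close> by auto
    then have "linf_dist (s n) x \<le> e / 2" if "n \<ge> N" for n
      using that unfolding linf_dist_le_iff[OF s \<open>x \<in> linf_plus\<close>] by blast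
    moreover have "e / 2 < e"
      using \<open>0 < e\<close> by simp
    ultimately show ?thesis
      using s le_less_trans by blast
  qed
  ultimately show "\<exists>x. limitin linf.mtopology s x sequentially"
    unfolding linf.limit_metric_sequentially by blast
qed

theorem theorem3p3:
  "Metric_space linf_plus linf_dist \<and> Metric_space.mcomplete linf_plus linf_dist"
  using Metric_space_linf_plus mcomplete_linf_plus by blast

end
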